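(* Let $n\ge3$, $r\ge2$, $2\le k\le n-1$, and let $X$ be a continuous random variable. Then both \[ E[X(n)\mid X(n-k)=u,\ X(n+r)=v]=\frac{ru+kv}{k+r}\qquad (l_F<u<v<r_F) \] and \[ E[X(n)\mid X(n-k+1)=u_2,\ X(n+r)=v]=\frac{ru_2+(k-1)v}{r+k-1}\qquad (l_F<u<u_2<v<r_F) \] hold if and only if $l_F>-\infty$, $r_F=\infty$ and $F(x)=1-e^{-c(x-l_F)}$ for $x\ge l_F$, for some constant $c>0$.
   Context: $X_1,X_2,\dots$ are i.i.d. copies of $X$ with distribution function $F$; $l_F=\inf\{x:F(x)>0\}$, $r_F=\sup\{x:F(x)<1\}$. Upper record times: $L(1)=1$, $L(m)=\min\{j>L(m-1): X_j>X_{L(m-1)}\}$; upper record values $X(m)=X_{L(m)}$. With $R(x)=-\ln(1-F(x))$, conditional expectations given $X(n-k)=u$, $X(n+r)=v$ are taken with respect to the conditional density $\frac{(k+r-1)!}{(k-1)!(r-1)!}[\frac{R(t)-R(u)}{R(v)-R(u)}]^{k-1}[\frac{R(v)-R(t)}{R(v)-R(u)}]^{r-1}\frac{R'(t)}{R(v)-R(u)}$, $u<t<v$. *)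

theory Defs
  imports "HOL-Analysis.Analysis"
begin

definition lF :: "(real \<Rightarrow> real) \<Rightarrow> ereal" where
  "lF F = Inf {ereal x | x. F x > 0}"

definition rF :: "(real \<Rightarrow> real) \<Rightarrow> ereal" where
  "rF F = Sup {ereal x | x. F x < 1}"

definition Rhaz :: "(real \<Rightarrow> real) \<Rightarrow> real \<Rightarrow> real" where
  "Rhaz F x = - ln (1 - F x)"

text \<open>Conditional density of X(n) given X(n-k) = u, X(n+r) = v (upper records).\<close>
definition rec_cdens :: "(real \<Rightarrow> real) \<Rightarrow> nat \<Rightarrow> nat \<Rightarrow> real \<Rightarrow> real \<Rightarrow> real \<Rightarrow> real" where
  "rec_cdens F k r u v t =
     (fact (k + r - 1) / (fact (k - 1) * fact (r - 1))) *
     ((Rhaz F t - Rhaz F u) / (Rhaz F v - Rhaz F u)) ^ (k - 1) *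
     ((Rhaz F v - Rhaz F t) / (Rhaz F v - Rhaz F u)) ^ (r - 1) *
     deriv (Rhaz F) t / (Rhaz F v - Rhaz F u)"

definition rec_condexp :: "(real \<Rightarrow> real) \<Rightarrow> nat \<Rightarrow> nat \<Rightarrow> real \<Rightarrow> real \<Rightarrow> real" where
  "rec_condexp F k r u v = (LBINT t=u..v. t * rec_cdens F k r u v t)"

end

theory Submission
  imports Defs
begin

text \<open>
  Let \<open>R\<close> be the cumulative hazard and \<open>\<phi>\<close> its inverse on the interior of the support.
  Substituting \<open>s = R t\<close> turns the conditional mean given \<open>X(n-k) = \<phi> a\<close>, \<open>X(n+r) = \<phi> b\<close> into a
  multiple of \<open>\<integral>\<^sub>a\<^sup>b \<phi>(s) (s - a)\<^bsup>k-1\<^esup> (b - s)\<^bsup>r-1\<^esup> ds\<close>. Differentiating the first regression identity in \<open>a\<close>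
  lowers the exponent \<open>k - 1\<close> to \<open>k - 2\<close>, so that the second identity evaluates the resulting integral.
  What remains is \<open>(b - a) \<phi>'(a) = \<phi>(b) - \<phi>(a)\<close> for all \<open>a < b\<close>; hence \<open>\<phi>\<close> is affine, which is
  the exponential law.

  \<open>F\<close> is only absolutely continuous, so \<open>R\<close> is differentiable merely almost everywhere. The substitution
  therefore needs that \<open>R\<close> maps null sets to null sets, and that \<open>deriv R\<close> is Borel measurable.
\<close>

section \<open>Indefinite integrals and beta integrals\<close>

text \<open>
  The library controls averages over \<open>[x, x + h]\<close> only; the left-hand derivative comes from the
  reflected integrand.
\<close>

lemma has_real_derivative_AE_if_indefinite_integral:
  fixes f F :: "real \<Rightarrow> real"
  assumes int: "\<And>a b. f integrable_on {a..b}"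
    and F: "\<And>a b. a \<le> b \<Longrightarrow> integral {a..b} f = F b - F a"
  obtains N where "negligible N" "\<And>x. x \<notin> N \<Longrightarrow> (F has_real_derivative f x) (at x)"
proof -
  obtain N1 where N1: "negligible N1" and r: "\<And>x e. \<lbrakk>x \<notin> N1; 0 < e\<rbrakk> \<Longrightarrow>
      \<exists>d>0. \<forall>h. 0 < h \<and> h < d \<longrightarrow> norm (integral (cbox x (x + h *\<^sub>R One)) f /\<^sub>R h ^ DIM(real) - f x) < e"
    using integrable_ccontinuous_explicit[of f] int by (metis interval_cbox)
  have int': "(\<lambda>x. f (- x)) integrable_on {a..b}" for a b
    using int[of "- b" "- a"] Henstock_Kurzweil_Integration.integrable_reflect_real[where f = f and a = "- b" and b = "- a"] by simp
  obtain N2 where N2: "negligible N2" and l: "\<And>x e. \<lbrakk>x \<notin> N2; 0 < e\<rbrakk> \<Longrightarrow>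
      \<exists>d>0. \<forall>h. 0 < h \<and> h < d \<longrightarrow>
        norm (integral (cbox x (x + h *\<^sub>R One)) (\<lambda>x. f (- x)) /\<^sub>R h ^ DIM(real) - f (- x)) < e"
    using integrable_ccontinuous_explicit[of "\<lambda>x. f (- x)"] int' by (metis (lifting) interval_cbox)
  show ?thesis
  proof (rule that[of "N1 \<union> uminus ` N2"])
    have "negligible (uminus ` N2)"
      by (rule negligible_differentiable_image_negligible[OF order_refl N2]) (intro derivative_intros)
    then show "negligible (N1 \<union> uminus ` N2)"
      using N1 by simp
  next
    fix x assume x: "x \<notin> N1 \<union> uminus ` N2"
    then have x1: "x \<notin> N1" and x2: "- x \<notin> N2"
      by (auto simp: image_iff)
    show "(F has_real_derivative f x) (at x)"
      unfolding DERIV_def LIM_eq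
    proof (intro allI impI)
      fix e :: real assume "e > 0"
      obtain d1 where d1: "d1 > 0"
        and right: "\<And>h. 0 < h \<Longrightarrow> h < d1 \<Longrightarrow> \<bar>integral {x..x + h} f / h - f x\<bar> < e"
        using r[OF x1 \<open>e > 0\<close>] by (auto simp: divide_inverse_commute)
      obtain d2 where d2: "d2 > 0"
        and left: "\<And>h. 0 < h \<Longrightarrow> h < d2 \<Longrightarrow> \<bar>integral {- x..- x + h} (\<lambda>x. f (- x)) / h - f x\<bar> < e"
        using l[OF x2 \<open>e > 0\<close>] by (auto simp: divide_inverse_commute)
      have "\<bar>(F (x + h) - F x) / h - f x\<bar> < e" if "h \<noteq> 0" "\<bar>h\<bar> < min d1 d2" for h
      proof (cases "h > 0")
        case True
        with that right[of h] F[of x "x + h"] show ?thesis by auto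
      next
        case False
        with that have "h < 0" by simp
        have "integral {- x..- x + (- h)} (\<lambda>x. f (- x)) = F x - F (x + h)"
          using Henstock_Kurzweil_Integration.integral_reflect_real[of x "x + h" f] F[of "x + h" x] \<open>h < 0\<close> by (simp add: algebra_simps)
        with left[of "- h"] that \<open>h < 0\<close> have "\<bar>(F x - F (x + h)) / (- h) - f x\<bar> < e" by simp
        then show ?thesis by (simp add: minus_divide_left)
      qed
      then show "\<exists>s>0. \<forall>h. h \<noteq> 0 \<and> norm (h - 0) < s \<longrightarrow> norm ((F (x + h) - F x) / h - f x) < e"
        using d1 d2 by (intro exI[of _ "min d1 d2"]) auto
    qed
  qed
qed

section \<open>Differentiation in the lower limit of integration\<close>

lemma has_real_derivative_integral_lower:
  fixes g :: "real \<Rightarrow> real"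
  assumes g: "continuous_on {p..b} g" and a: "p < a" "a < b"
  shows "((\<lambda>a. integral {a..b} g) has_real_derivative - g a) (at a)"
proof -
  have int: "g integrable_on {p..b}"
    using g by (rule integrable_continuous_real)
  have "((\<lambda>a. integral {p..a} g) has_real_derivative g a) (at a within {p..b})"
    using integral_has_vector_derivative[OF g, of a] a
    by (simp add: has_real_derivative_iff_has_vector_derivative)
  then have "((\<lambda>a. integral {p..a} g) has_real_derivative g a) (at a)"
    using a by (simp add: at_within_Icc_at)
  then have "((\<lambda>a. integral {p..b} g - integral {p..a} g) has_real_derivative - g a) (at a)"
    by (auto intro!: derivative_eq_intros)
  then show ?thesis
  proof (rule has_field_derivative_transform_within_open[where S = "{p<..<b}"])
    fix x assume "x \<in> {p<..<b}"
    then show "integral {p..b} g - integral {p..x} g = integral {x..b} g"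
      using Henstock_Kurzweil_Integration.integral_combine[of p x b g] int by simp
  qed (use a in auto)
qed

text \<open>Leibniz rule; there is no boundary term because the integrand vanishes at
  \<open>s = a\<close>. Splitting one factor \<open>s - a\<close> moves the parameter out of the
  integrand at the cost of replacing \<open>g s\<close> by \<open>g s * s\<close>, so the induction
  must range over all \<open>g\<close>. The point \<open>p\<close> left of \<open>a\<close> leaves
  room for a two-sided derivative.\<close>

lemma has_real_derivative_integral_mult_power:
  fixes g :: "real \<Rightarrow> real"
  assumes "continuous_on {p..b} g" "p < a" "a < b"
  shows "((\<lambda>a. integral {a..b} (\<lambda>s. g s * (s - a) ^ Suc m)) has_real_derivative
           - real (Suc m) * integral {a..b} (\<lambda>s. g s * (s - a) ^ m)) (at a)"
  using assms(1)
proof (induction m arbitrary: g)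
  case 0
  have int: "(\<lambda>s. g s * s) integrable_on {x..b}" "g integrable_on {x..b}" if "p < x" for x
    using continuous_on_subset[OF 0, of "{x..b}"] that
    by (auto intro!: integrable_continuous_real continuous_intros)
  \<comment> \<open>The two boundary terms \<open>g a * a\<close> cancel, leaving minus the integral
    of \<open>g\<close>.\<close>
  have *: "((\<lambda>a. integral {a..b} (\<lambda>s. g s * s) - a * integral {a..b} g) has_real_derivative
      - (g a * a) - (1 * integral {a..b} g + a * (- g a))) (at a)"
    by (rule derivative_eq_intros has_real_derivative_integral_lower assms(2,3) 0 continuous_intros refl)+
       simp
  then have "((\<lambda>a. integral {a..b} (\<lambda>s. g s * (s - a) ^ Suc 0)) has_real_derivative
      - (g a * a) - (1 * integral {a..b} g + a * (- g a))) (at a)"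
  proof (rule has_field_derivative_transform_within_open[where S = "{p<..<b}"])
    fix x assume "x \<in> {p<..<b}"
    then show "integral {x..b} (\<lambda>s. g s * s) - x * integral {x..b} g = integral {x..b} (\<lambda>s. g s * (s - x) ^ Suc 0)"
      using int[of x]
      by (simp add: right_diff_distrib integral_diff integrable_on_mult_left integral_mult_left mult.commute[of x])
  qed (use assms in auto)
  then show ?case by (simp add: algebra_simps)
next
  case (Suc m)
  have cont: "continuous_on {p..b} (\<lambda>s. g s * s)"
    using Suc.prems by (intro continuous_intros)
  have split: "integral {x..b} (\<lambda>s. (g s * s) * (s - x) ^ n) - x * integral {x..b} (\<lambda>s. g s * (s - x) ^ n)
      = integral {x..b} (\<lambda>s. g s * (s - x) ^ Suc n)" if "p < x" for x n
  proof -
    have int: "(\<lambda>s. (g s * s) * (s - x) ^ n) integrable_on {x..b}" "(\<lambda>s. g s * (s - x) ^ n) integrable_on {x..b}"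
      using continuous_on_subset[OF Suc.prems, of "{x..b}"] that
      by (auto intro!: integrable_continuous_real continuous_intros)
    have "integral {x..b} (\<lambda>s. g s * (s - x) ^ Suc n)
        = integral {x..b} (\<lambda>s. (g s * s) * (s - x) ^ n - x * (g s * (s - x) ^ n))"
      by (simp add: algebra_simps)
    also have "\<dots> = integral {x..b} (\<lambda>s. (g s * s) * (s - x) ^ n) - integral {x..b} (\<lambda>s. x * (g s * (s - x) ^ n))"
      by (rule integral_diff) (use int in \<open>auto intro: integrable_on_mult_right\<close>)
    finally show ?thesis by simp
  qed
  \<comment> \<open>The induction hypothesis is used twice, for \<open>g s * s\<close> and for
    \<open>g\<close>.\<close>
  have "((\<lambda>a. integral {a..b} (\<lambda>s. (g s * s) * (s - a) ^ Suc m) - a * integral {a..b} (\<lambda>s. g s * (s - a) ^ Suc m))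
      has_real_derivative
      - real (Suc m) * integral {a..b} (\<lambda>s. (g s * s) * (s - a) ^ m)
      - (1 * integral {a..b} (\<lambda>s. g s * (s - a) ^ Suc m)
         + a * (- real (Suc m) * integral {a..b} (\<lambda>s. g s * (s - a) ^ m)))) (at a)"
    by (rule derivative_eq_intros Suc.IH Suc.prems cont refl)+ simp
  then have "((\<lambda>a. integral {a..b} (\<lambda>s. g s * (s - a) ^ Suc (Suc m)))
      has_real_derivative
      - real (Suc m) * integral {a..b} (\<lambda>s. (g s * s) * (s - a) ^ m)
      - (1 * integral {a..b} (\<lambda>s. g s * (s - a) ^ Suc m)
         + a * (- real (Suc m) * integral {a..b} (\<lambda>s. g s * (s - a) ^ m)))) (at a)"
    by (rule has_field_derivative_transform_within_open[where S = "{p<..<b}"])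
       (use assms split in \<open>auto simp del: power_Suc\<close>)
  \<comment> \<open>By \<open>split\<close> the two terms with factor \<open>Suc m\<close> recombine
    to \<open>Suc m\<close> times the integral with exponent \<open>Suc m\<close>; the product rule
    contributes one more copy of it.\<close>
  then show ?case
    using split[OF assms(2), of m] by (simp add: algebra_simps)
qed

text \<open>Euler's beta integral. Integration by parts trades a power of \<open>v - t\<close> for
  one of \<open>t - u\<close>, hence \<open>m\<close> is arbitrary in the induction on
  \<open>n\<close>.\<close>

lemma integral_power_mult_power:
  fixes u v :: real
  assumes "u \<le> v"
  shows "integral {u..v} (\<lambda>t. (t - u) ^ m * (v - t) ^ n) = fact m * fact n / fact (m + n + 1) * (v - u) ^ (m + n + 1)"
proof (induction n arbitrary: m)
  case 0
  have "((\<lambda>t. (t - u) ^ m) has_integral ((v - u) ^ (m + 1) / (m + 1) - (u - u) ^ (m + 1) / (m + 1))) {u..v}"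
    by (rule fundamental_theorem_of_calculus[OF assms])
       (auto intro!: derivative_eq_intros simp del: power_Suc simp: has_real_derivative_iff_has_vector_derivative[symmetric])
  then show ?case
    by (simp add: integral_unique)
next
  case (Suc n)
  have cont: "(\<lambda>t. (t - u) ^ i * (v - t) ^ j) integrable_on {u..v}" for i j
    by (intro integrable_continuous_real continuous_intros)
  \<comment> \<open>The integrand is the derivative of
    \<open>(t - u) ^ Suc m * (v - t) ^ Suc n\<close>, which vanishes at both endpoints.\<close>
  have "((\<lambda>t. (m + 1) * ((t - u) ^ m * (v - t) ^ Suc n) - (n + 1) * ((t - u) ^ Suc m * (v - t) ^ n)) has_integral
      ((v - u) ^ Suc m * (v - v) ^ Suc n - (u - u) ^ Suc m * (v - u) ^ Suc n)) {u..v}"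
    by (rule fundamental_theorem_of_calculus[OF assms])
       (auto intro!: derivative_eq_intros simp del: power_Suc simp: has_real_derivative_iff_has_vector_derivative[symmetric] algebra_simps)
  then have "0 = integral {u..v} (\<lambda>t. (m + 1) * ((t - u) ^ m * (v - t) ^ Suc n) - (n + 1) * ((t - u) ^ Suc m * (v - t) ^ n))"
    by (simp add: integral_unique)
  also have "\<dots> = (m + 1) * integral {u..v} (\<lambda>t. (t - u) ^ m * (v - t) ^ Suc n)
       - (n + 1) * integral {u..v} (\<lambda>t. (t - u) ^ Suc m * (v - t) ^ n)"
    using cont[of m "Suc n"] cont[of "Suc m" n]
    by (subst integral_diff) (auto intro!: integrable_on_mult_right)
  also have "integral {u..v} (\<lambda>t. (t - u) ^ Suc m * (v - t) ^ n)
      = fact (Suc m) * fact n / fact (Suc m + n + 1) * (v - u) ^ (Suc m + n + 1)"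
    by (rule Suc)
  finally have eq: "(real m + 1) * integral {u..v} (\<lambda>t. (t - u) ^ m * (v - t) ^ Suc n)
      = (real m + 1) * (fact m * fact (Suc n) / fact (m + Suc n + 1) * (v - u) ^ (m + Suc n + 1))"
    by (simp add: field_simps)
  have "real m + 1 \<noteq> 0"
    by linarith
  from mult_left_cancel[OF this, THEN iffD1, OF eq] show ?case .
qed

text \<open>The identity for \<open>Suc m\<close> can be solved for \<open>\<phi> x\<close>, which
  shows that \<open>\<phi>\<close> is differentiable. Its derivative contains the integral with
  exponent \<open>m\<close>, which the identity for \<open>m\<close> evaluates; the result collapses
  to the slope of the chord from \<open>a\<close> to \<open>b\<close>.\<close>

lemma has_real_derivative_if_beta_means:
  fixes \<phi> :: "real \<Rightarrow> real"
  assumes cont: "continuous_on {p..b} \<phi>" and a: "p < a" "a < b"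
    and mean: "\<And>x j. p < x \<Longrightarrow> x < b \<Longrightarrow> j \<in> {m, Suc m} \<Longrightarrow>
      integral {x..b} (\<lambda>s. \<phi> s * ((s - x) ^ j * (b - s) ^ n)) =
        fact j * fact n / fact (j + n + 2) * (b - x) ^ (j + n + 1) * (real (n + 1) * \<phi> x + real (j + 1) * \<phi> b)"
  shows "(\<phi> has_real_derivative (\<phi> b - \<phi> a) / (b - a)) (at a)"
proof -
  define g where "g s = \<phi> s * (b - s) ^ n" for s
  define G where "G j x = integral {x..b} (\<lambda>s. g s * (s - x) ^ j)" for j x
  \<comment> \<open>\<open>C\<close> is the constant for which
    \<open>C * G (Suc m) x / (b - x) ^ (m + n + 2)\<close> is the weighted sum of
    \<open>\<phi> x\<close> and \<open>\<phi> b\<close>.\<close>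
  define C :: real where "C = fact (m + n + 3) / (fact (Suc m) * fact n)"
  define d where "d = b - a"
  have d0: "d \<noteq> 0" using a by (simp add: d_def)
  have G: "G j x = fact j * fact n / fact (j + n + 2) * (b - x) ^ (j + n + 1) * (real (n + 1) * \<phi> x + real (j + 1) * \<phi> b)"
    if "p < x" "x < b" "j \<in> {m, Suc m}" for x j
    using mean[OF that] unfolding G_def g_def by (simp add: mult_ac)
  have "continuous_on {p..b} g"
    unfolding g_def using cont by (intro continuous_intros)
  then have "(G (Suc m) has_real_derivative - real (Suc m) * G m a) (at a)"
    unfolding G_def using a by (rule has_real_derivative_integral_mult_power)
  moreover have "((\<lambda>x. (b - x) ^ (m + n + 2)) has_real_derivative - (real (m + n + 2) * (b - a) ^ (m + n + 1))) (at a)"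
    by (auto intro!: derivative_eq_intros simp del: power_Suc of_nat_Suc)
  moreover have "(b - a) ^ (m + n + 2) \<noteq> 0"
    using a by simp
  ultimately have "((\<lambda>x. G (Suc m) x / (b - x) ^ (m + n + 2)) has_real_derivative
      (- real (Suc m) * G m a * d ^ (m + n + 2) + G (Suc m) a * (real (m + n + 2) * d ^ (m + n + 1)))
          / (d ^ (m + n + 2) * d ^ (m + n + 2))) (at a)"
    unfolding d_def by (rule DERIV_divide[THEN DERIV_cong]) simp
  from DERIV_cdivide[OF DERIV_diff[OF DERIV_cmult[OF this, of C] DERIV_const[of "real (m + 2) * \<phi> b"]], of "real (n + 1)"]
  have deriv: "((\<lambda>x. (C * (G (Suc m) x / (b - x) ^ (m + n + 2)) - real (m + 2) * \<phi> b) / real (n + 1)) has_real_derivative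
      C * ((- real (Suc m) * G m a * d ^ (m + n + 2) + G (Suc m) a * (real (m + n + 2) * d ^ (m + n + 1)))
          / (d ^ (m + n + 2) * d ^ (m + n + 2))) / real (n + 1)) (at a)"
    by (simp del: power_Suc of_nat_Suc)
  have eq: "(C * (G (Suc m) x / (b - x) ^ (m + n + 2)) - real (m + 2) * \<phi> b) / real (n + 1) = \<phi> x"
    if "x \<in> {p<..<b}" for x
  proof -
    have "C * (G (Suc m) x / (b - x) ^ (m + n + 2)) = real (n + 1) * \<phi> x + real (m + 2) * \<phi> b"
      using that G[of x "Suc m"] by (simp add: C_def numeral_3_eq_3 del: power_Suc fact_Suc of_nat_Suc)
    then show ?thesis by (simp add: field_simps)
  qed
  from deriv have "(\<phi> has_real_derivative
      C * ((- real (Suc m) * G m a * d ^ (m + n + 2) + G (Suc m) a * (real (m + n + 2) * d ^ (m + n + 1)))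
          / (d ^ (m + n + 2) * d ^ (m + n + 2))) / real (n + 1)) (at a)"
    by (rule has_field_derivative_transform_within_open[where S = "{p<..<b}"]) (use a eq in auto)
  moreover have "C * ((- real (Suc m) * G m a * d ^ (m + n + 2) + G (Suc m) a * (real (m + n + 2) * d ^ (m + n + 1)))
          / (d ^ (m + n + 2) * d ^ (m + n + 2))) / real (n + 1) = (\<phi> b - \<phi> a) / d"
  proof -
    have G1: "C * G (Suc m) a = d ^ (m + n + 2) * (real (n + 1) * \<phi> a + real (m + 2) * \<phi> b)"
      using a G[of a "Suc m"] by (simp add: C_def d_def numeral_3_eq_3 del: power_Suc fact_Suc of_nat_Suc)
    have fact3: "fact (m + n + 3) = real (m + n + 3) * fact (m + n + 2)"
      by (simp add: numeral_3_eq_3)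
    have G0: "C * (real (Suc m) * G m a) = real (m + n + 3) * d ^ (m + n + 1) * (real (n + 1) * \<phi> a + real (m + 1) * \<phi> b)"
      using a G[of a m] unfolding C_def fact3 by (simp add: d_def del: power_Suc)
    have dS: "d ^ (m + n + 2) = d * d ^ (m + n + 1)" by simp
    have "C * (- real (Suc m) * G m a * d ^ (m + n + 2) + G (Suc m) a * (real (m + n + 2) * d ^ (m + n + 1)))
      = - (C * (real (Suc m) * G m a)) * d ^ (m + n + 2) + (C * G (Suc m) a) * real (m + n + 2) * d ^ (m + n + 1)"
      by (simp add: algebra_simps del: power_Suc of_nat_Suc)
    \<comment> \<open>The coefficient of \<open>\<phi> b\<close> is
      \<open>(m + n + 2) * (m + 2) - (m + n + 3) * (m + 1) = n + 1\<close>, that of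
      \<open>\<phi> a\<close> is \<open>- (n + 1)\<close>.\<close>
    also have "\<dots> = d ^ (m + n + 1) * d ^ (m + n + 2) * (real (n + 1) * (\<phi> b - \<phi> a))"
      unfolding G0 G1 by (simp add: algebra_simps del: power_Suc)
    finally have eq: "C * (- real (Suc m) * G m a * d ^ (m + n + 2) + G (Suc m) a * (real (m + n + 2) * d ^ (m + n + 1)))
      = d ^ (m + n + 1) * d ^ (m + n + 2) * (real (n + 1) * (\<phi> b - \<phi> a))" .
    have cancel: "C * (X / (Q * Q)) / c = D / d" if "C * X = q * Q * (c * D)" "Q = d * q" "q \<noteq> 0" "c \<noteq> 0"
      for X q Q c D :: real
    proof -
      have "C * (X / (Q * Q)) / c = (C * X) / (Q * Q * c)" by simp
      also have "\<dots> = D / d" unfolding that(1) using that(2-) d0 by simp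
      finally show ?thesis .
    qed
    show ?thesis
      by (rule cancel[OF eq dS]) (use d0 in auto)
  qed
  ultimately show ?thesis
    by (simp add: d_def)
qed

section \<open>Distribution functions with a density\<close>

text \<open>A continuous random variable is read as one with a density, so \<open>F\<close> is
  absolutely continuous; \<open>f\<close> itself need not be continuous.\<close>

locale density_cdf =
  fixes f F :: "real \<Rightarrow> real"
  assumes f_meas: "f \<in> borel_measurable lborel"
    and f_nonneg: "\<And>x. f x \<ge> 0"
    and f_int: "integrable lborel f"
    and f_total: "(LINT t|lborel. f t) = 1"
    and F_def: "\<And>x. F x = (LINT t:{..x}|lborel. f t)"
begin

section \<open>Elementary properties of a distribution function with a density\<close>

lemma set_integrable_density: "A \<in> sets borel \<Longrightarrow> set_integrable lborel A f"
  unfolding set_integrable_def using integrable_mult_indicator[OF _ f_int, of A] by simp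

lemma integrable_on_density: "f integrable_on {a..b}"
  by (rule set_borel_integral_eq_integral(1)) (simp add: set_integrable_density)

lemma F_diff:
  assumes "a \<le> b"
  shows "integral {a..b} f = F b - F a"
proof -
  have "{..b} = {..a} \<union> {a<..b}" using assms by auto
  then have "F b = (LINT t:{..a} \<union> {a<..b}|lborel. f t)"
    unfolding F_def by simp
  also have "\<dots> = F a + (LINT t:{a<..b}|lborel. f t)"
    unfolding F_def by (rule set_integral_Un) (auto simp: set_integrable_density)
  also have "(LINT t:{a<..b}|lborel. f t) = integral {a<..b} f"
    by (rule set_borel_integral_eq_integral) (simp add: set_integrable_density)
  also have "\<dots> = integral {a..b} f"
    by (rule integral_spike_set) (auto intro: negligible_subset[of "{a}"])
  finally show ?thesis by simp
qed

lemma F_mono: "a \<le> b \<Longrightarrow> F a \<le> F b"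
  using F_diff[of a b] Henstock_Kurzweil_Integration.integral_nonneg[OF integrable_on_density[of a b]] f_nonneg by force

lemma continuous_on_F: "continuous_on S F"
proof -
  have "isCont F x" for x
  proof -
    have "continuous_on {x - 1..x + 1} (\<lambda>y. F (x - 1) + integral {x - 1..y} f)"
      by (intro continuous_intros indefinite_integral_continuous_1 integrable_on_density)
    then have "continuous_on {x - 1..x + 1} F"
      by (rule continuous_on_eq) (simp add: F_diff)
    then show ?thesis
      by (rule continuous_on_interior) simp
  qed
  then show ?thesis
    by (simp add: continuous_at_imp_continuous_on)
qed

lemma F_at_top: "(F \<longlongrightarrow> 1) at_top"
proof -
  have "((\<lambda>b. LINT t:{0..b}|lborel. f t) \<longlongrightarrow> (LINT t:{0..}|lborel. f t)) at_top"
    by (rule tendsto_set_lebesgue_integral_at_top) (simp_all add: set_integrable_density)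
  then have lim: "((\<lambda>b. (LINT t:{..<0}|lborel. f t) + (LINT t:{0..b}|lborel. f t)) \<longlongrightarrow>
      (LINT t:{..<0}|lborel. f t) + (LINT t:{0..}|lborel. f t)) at_top"
    by (intro tendsto_intros)
  have "(LINT t:{..<0}|lborel. f t) + (LINT t:{0..}|lborel. f t) = (LINT t:{..<0} \<union> {0..}|lborel. f t)"
    by (rule set_integral_Un[symmetric]) (auto simp: set_integrable_density)
  moreover have "{..<0} \<union> {0..} = (UNIV :: real set)" by auto
  moreover have "(LINT t:UNIV|lborel. f t) = 1"
    using f_total by (simp add: set_lebesgue_integral_def)
  ultimately have total: "(LINT t:{..<0}|lborel. f t) + (LINT t:{0..}|lborel. f t) = 1"
    by simp
  have "\<forall>\<^sub>F b in at_top. (LINT t:{..<0}|lborel. f t) + (LINT t:{0..b}|lborel. f t) = F b"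
    using eventually_ge_at_top[of 0]
  proof eventually_elim
    case (elim b)
    then have "{..b} = {..<0} \<union> {0..b}" by auto
    then show ?case
      unfolding F_def by (simp add: set_integral_Un set_integrable_density disjoint_iff)
  qed
  with lim show ?thesis
    unfolding total by (rule Lim_transform_eventually)
qed

lemma F_at_bot: "(F \<longlongrightarrow> 0) at_bot"
proof -
  have "((\<lambda>a. LINT t:{a..0}|lborel. f t) \<longlongrightarrow> (LINT t:{..0}|lborel. f t)) at_bot"
    by (rule tendsto_set_lebesgue_integral_at_bot) (simp_all add: set_integrable_density)
  then have lim: "((\<lambda>a. F 0 - (LINT t:{a..0}|lborel. f t)) \<longlongrightarrow> F 0 - F 0) at_bot"
    unfolding F_def by (intro tendsto_intros)
  have "\<forall>\<^sub>F a in at_bot. F 0 - (LINT t:{a..0}|lborel. f t) = F a"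
    using eventually_le_at_bot[of 0]
  proof eventually_elim
    case (elim a)
    have "(LINT t:{a..0}|lborel. f t) = integral {a..0} f"
      by (rule set_borel_integral_eq_integral) (simp add: set_integrable_density)
    with F_diff[OF elim] show ?case by simp
  qed
  with lim show ?thesis
    unfolding diff_self by (rule Lim_transform_eventually)
qed

lemma F_nonneg: "0 \<le> F x"
  unfolding F_def set_lebesgue_integral_def by (rule integral_nonneg_AE) (simp add: f_nonneg)

lemma F_le_1: "F x \<le> 1"
proof (rule tendsto_lowerbound[OF F_at_top])
  show "\<forall>\<^sub>F y in at_top. F x \<le> F y"
    using eventually_ge_at_top[of x] by eventually_elim (rule F_mono)
qed simp

lemma F_attains:
  assumes "0 < y" "y < 1"
  obtains x where "F x = y"
proof -
  obtain a where a: "F a < y"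
    using eventually_happens'[OF trivial_limit_at_bot_linorder order_tendstoD(2)[OF F_at_bot assms(1)]] by blast
  obtain b where b: "y < F b"
    using eventually_happens'[OF trivial_limit_at_top_linorder order_tendstoD(1)[OF F_at_top assms(2)]] by blast
  have "a \<le> b" using a b F_mono[of b a] by linarith
  then show ?thesis
    using IVT'[of F a y b] a b continuous_on_F that by force
qed

text \<open>By continuity \<open>F\<close> stays positive slightly to the left of \<open>u\<close>,
  so the infimum lies strictly below \<open>u\<close>. The lemma turns the range condition on
  \<open>u\<close> into a condition on \<open>F u\<close>.\<close>

lemma lF_less_iff: "lF F < ereal u \<longleftrightarrow> 0 < F u"
proof
  assume "lF F < ereal u"
  then obtain x where "0 < F x" "x < u"
    unfolding lF_def Inf_less_iff by auto
  then show "0 < F u"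
    using F_mono[of x u] by linarith
next
  assume u: "0 < F u"
  have "F \<midarrow>u\<rightarrow> F u"
    using continuous_on_F[of UNIV] by (simp add: continuous_on_def)
  from order_tendstoD(1)[OF this u] obtain d where "d > 0" "\<And>x. x \<noteq> u \<Longrightarrow> dist x u < d \<Longrightarrow> 0 < F x"
    unfolding eventually_at by auto
  from this(1) this(2)[of "u - d / 2"] have "0 < F (u - d / 2)"
    by (simp add: dist_real_def)
  then have "lF F \<le> ereal (u - d / 2)"
    unfolding lF_def by (auto intro!: Inf_lower)
  also have "\<dots> < ereal u" using \<open>d > 0\<close> by simp
  finally show "lF F < ereal u" .
qed

lemma less_rF_iff: "ereal v < rF F \<longleftrightarrow> F v < 1"
proof
  assume "ereal v < rF F"
  then obtain x where "F x < 1" "v < x"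
    unfolding rF_def less_Sup_iff by auto
  then show "F v < 1"
    using F_mono[of v x] by linarith
next
  assume v: "F v < 1"
  have "F \<midarrow>v\<rightarrow> F v"
    using continuous_on_F[of UNIV] by (simp add: continuous_on_def)
  from order_tendstoD(2)[OF this v] obtain d where "d > 0" "\<And>x. x \<noteq> v \<Longrightarrow> dist x v < d \<Longrightarrow> F x < 1"
    unfolding eventually_at by auto
  from this(1) this(2)[of "v + d / 2"] have "F (v + d / 2) < 1"
    by (simp add: dist_real_def)
  then have "ereal (v + d / 2) \<le> rF F"
    unfolding rF_def by (auto intro!: Sup_upper)
  moreover have "ereal v < ereal (v + d / 2)" using \<open>d > 0\<close> by simp
  ultimately show "ereal v < rF F" by (rule less_le_trans[rotated])
qed

section \<open>The interval between the endpoints, and the cumulative hazard on it\<close>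

lemma F_measurable [measurable]: "F \<in> borel_measurable borel"
  using continuous_on_F by (rule borel_measurable_continuous_onI)

lemma Rhaz_measurable [measurable]: "Rhaz F \<in> borel_measurable borel"
  unfolding Rhaz_def by measurable

text \<open>By \<open>lF_less_iff\<close> and \<open>less_rF_iff\<close> this is the open interval
  from \<open>lF F\<close> to \<open>rF F\<close>. A priori \<open>F\<close> may be flat on parts of
  it.\<close>

definition supp :: "real set" where
  "supp = {x. 0 < F x \<and> F x < 1}"

lemma supp_between: "u \<in> supp \<Longrightarrow> v \<in> supp \<Longrightarrow> u \<le> x \<Longrightarrow> x \<le> v \<Longrightarrow> x \<in> supp"
  unfolding supp_def using F_mono[of u x] F_mono[of x v] by auto

lemma supp_nonempty: obtains x where "x \<in> supp"
proof (rule F_attains)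
  fix x assume "F x = 1 / 2"
  then show thesis by (intro that[of x]) (simp add: supp_def)
qed simp_all

text \<open>The level halfway between \<open>F v\<close> and 1 is attained by continuity, and
  monotonicity places the point to the right of \<open>v\<close>.\<close>

lemma supp_no_max:
  assumes "v \<in> supp" obtains w where "w \<in> supp" "v < w"
proof -
  from assms have "0 < F v" "F v < 1" by (auto simp: supp_def)
  obtain w where w: "F w = (F v + 1) / 2"
    by (rule F_attains[of "(F v + 1) / 2"]) (use \<open>0 < F v\<close> \<open>F v < 1\<close> in auto)
  have "v < w"
  proof (rule ccontr)
    assume "\<not> v < w"
    then have "F w \<le> F v" by (intro F_mono) simp
    with w \<open>F v < 1\<close> show False by simp
  qed
  with w \<open>0 < F v\<close> \<open>F v < 1\<close> show ?thesis
    by (intro that[of w]) (auto simp: supp_def)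
qed

lemma supp_no_min:
  assumes "v \<in> supp" obtains w where "w \<in> supp" "w < v"
proof -
  from assms have "0 < F v" "F v < 1" by (auto simp: supp_def)
  obtain w where w: "F w = F v / 2"
    by (rule F_attains[of "F v / 2"]) (use \<open>0 < F v\<close> \<open>F v < 1\<close> in auto)
  have "w < v"
  proof (rule ccontr)
    assume "\<not> w < v"
    then have "F v \<le> F w" by (intro F_mono) simp
    with w \<open>0 < F v\<close> show False by simp
  qed
  with w \<open>0 < F v\<close> \<open>F v < 1\<close> show ?thesis
    by (intro that[of w]) (auto simp: supp_def)
qed

lemma continuous_on_Rhaz: "S \<subseteq> supp \<Longrightarrow> continuous_on S (Rhaz F)"
  unfolding Rhaz_def supp_def by (intro continuous_intros continuous_on_F) auto

lemma Rhaz_strict_mono: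
  assumes "F x < F y" "F y < 1"
  shows "Rhaz F x < Rhaz F y"
  using assms unfolding Rhaz_def by simp

lemma exp_Rhaz: "x \<in> supp \<Longrightarrow> F x = 1 - exp (- Rhaz F x)"
  by (simp add: Rhaz_def supp_def)

lemma Rhaz_has_derivative:
  assumes "(F has_real_derivative f x) (at x)" "x \<in> supp"
  shows "(Rhaz F has_real_derivative f x / (1 - F x)) (at x)"
  using assms unfolding Rhaz_def supp_def by (auto intro!: derivative_eq_intros)

text \<open>Lusin's property (N). The image under \<open>F\<close> of the points of
  differentiability has measure equal to the integral of \<open>f\<close>, which is the full
  increment \<open>F v - F u\<close>. Since \<open>F\<close> is injective, the image of the
  exceptional points is disjoint from it, hence null.\<close>

lemma negligible_Rhaz_image:
  assumes N: "negligible N" "\<And>x. x \<notin> N \<Longrightarrow> (F has_real_derivative f x) (at x)"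
    and uv: "u \<in> supp" "v \<in> supp" "u < v" and strict: "strict_mono_on supp F"
  shows "negligible (Rhaz F ` ({u<..<v} \<inter> N))"
proof -
  define S where "S = {u<..<v} - N"
  have sub: "{u<..<v} \<subseteq> supp" using supp_between[OF uv(1,2)] by auto
  have inj: "inj_on F supp" using strict by (rule strict_mono_on_imp_inj_on)
  have S: "S \<in> sets lebesgue"
    unfolding S_def using N(1) by (simp add: negligible_imp_sets sets.Diff)
  have der: "(F has_real_derivative f x) (at x within S)" if "x \<in> S" for x
    using N(2)[of x] that by (auto simp: S_def intro: has_field_derivative_at_within)
  have injS: "inj_on F S"
    by (rule inj_on_subset[OF inj]) (use sub in \<open>auto simp: S_def\<close>)
  have f: "f absolutely_integrable_on {u<..<v}"
    using integrable_on_density[of u v] f_nonneg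
    by (subst absolutely_integrable_on_Icc_iff_Ioo[symmetric]) (simp add: absolutely_integrable_on_iff_nonneg)
  have neg: "negligible {x \<in> {u<..<v} - S. f x \<noteq> 0}" "negligible {x \<in> S - {u<..<v}. f x \<noteq> 0}"
    by (auto intro: negligible_subset[OF N(1)] simp: S_def)
  have "f absolutely_integrable_on S \<and> integral S f = F v - F u"
    using absolutely_integrable_spike_set[OF f neg] integral_spike_set[OF neg] F_diff[of u v] uv(3)
    by (simp add: integral_open_interval_real[symmetric])
  \<comment> \<open>With Jacobian \<open>\<bar>f x\<bar>\<close> and integrand 1, the change of
    variables formula computes the measure of the image of \<open>S\<close>.\<close>
  then have "(\<lambda>x. \<bar>f x\<bar> * 1) absolutely_integrable_on S \<and> integral S (\<lambda>x. \<bar>f x\<bar> * 1) = F v - F u"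
    using f_nonneg by simp
  then have "(\<lambda>x. 1 :: real) absolutely_integrable_on F ` S \<and> integral (F ` S) (\<lambda>x. 1) = F v - F u"
    by (subst (asm) has_absolute_integral_change_of_variables_1'[OF S der injS])
  then have img: "F ` S \<in> lmeasurable" "measure lebesgue (F ` S) = F v - F u"
    unfolding lmeasurable_iff_integrable_on[symmetric] absolutely_integrable_on_def
    using lmeasure_integral[of "F ` S"] by metis+
  have img_sub: "F ` {u<..<v} \<subseteq> {F u..F v}"
    using F_mono by auto
  \<comment> \<open>\<open>F ` S\<close> already has full measure, so the disjoint image of the exceptional set is null.\<close>
  have "negligible ({F u..F v} - F ` S)"
  proof -
    have "measure lebesgue ({F u..F v} - F ` S) = measure lebesgue {F u..F v} - measure lebesgue (F ` S)"
      using img(1) img_sub by (intro measurable_measure_Diff) (auto simp: S_def)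
    also have "\<dots> = 0" using img(2) F_mono[of u v] uv(3) by simp
    finally show ?thesis
      using img(1) by (subst negligible_iff_measure0) (auto intro: fmeasurable_Diff)
  qed
  moreover have "F ` ({u<..<v} \<inter> N) \<subseteq> {F u..F v} - F ` S"
  proof
    fix y assume "y \<in> F ` ({u<..<v} \<inter> N)"
    then obtain x where x: "x \<in> {u<..<v}" "x \<in> N" "y = F x" by blast
    have "y \<notin> F ` S"
    proof
      assume "y \<in> F ` S"
      then obtain x' where x': "x' \<in> S" "F x' = F x" using x by auto
      have "x' = x" by (rule inj_onD[OF inj]) (use x x' sub in \<open>auto simp: S_def\<close>)
      with x' x show False by (simp add: S_def)
    qed
    then show "y \<in> {F u..F v} - F ` S" using x img_sub by blast
  qed
  ultimately have "negligible (F ` ({u<..<v} \<inter> N))"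
    by (rule negligible_subset)
  \<comment> \<open>\<open>Rhaz F\<close> is \<open>F\<close> followed by a map differentiable below
    1, and differentiable maps preserve null sets.\<close>
  then have "negligible ((\<lambda>y. - ln (1 - y)) ` F ` ({u<..<v} \<inter> N))"
  proof (rule negligible_differentiable_image_negligible[OF order_refl])
    show "(\<lambda>y. - ln (1 - y)) differentiable_on F ` ({u<..<v} \<inter> N)"
      unfolding differentiable_on_def
    proof
      fix y assume "y \<in> F ` ({u<..<v} \<inter> N)"
      then have "y < 1" using sub by (auto simp: supp_def)
      then have "((\<lambda>y. - ln (1 - y)) has_real_derivative 1 / (1 - y)) (at y)"
        by (auto intro!: derivative_eq_intros)
      then show "(\<lambda>y. - ln (1 - y)) differentiable at y within F ` ({u<..<v} \<inter> N)"
        by (rule differentiableI[OF has_field_derivative_imp_has_derivative[OF has_field_derivative_at_within]])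
    qed
  qed
  then show ?thesis
    by (simp add: image_image Rhaz_def)
qed

section \<open>Substituting the cumulative hazard\<close>

lemma Rhaz_less:
  assumes strict: "strict_mono_on supp F" and xy: "x \<in> supp" "y \<in> supp" "x < y"
  shows "Rhaz F x < Rhaz F y"
  by (rule Rhaz_strict_mono) (use strict_mono_onD[OF strict xy] xy in \<open>auto simp: supp_def\<close>)

lemma inj_on_Rhaz:
  assumes "strict_mono_on supp F" shows "inj_on (Rhaz F) supp"
  by (intro strict_mono_on_imp_inj_on strict_mono_onI Rhaz_less[OF assms])

lemma Rhaz_image_Icc:
  assumes strict: "strict_mono_on supp F" and uv: "u \<in> supp" "v \<in> supp" "u < v"
  shows "Rhaz F ` {u..v} = {Rhaz F u..Rhaz F v}"
proof
  have sub: "{u..v} \<subseteq> supp" using supp_between[OF uv(1,2)] by auto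
  show "Rhaz F ` {u..v} \<subseteq> {Rhaz F u..Rhaz F v}"
  proof
    fix y assume "y \<in> Rhaz F ` {u..v}"
    then obtain x where x: "u \<le> x" "x \<le> v" "y = Rhaz F x" by auto
    then have "x \<in> supp" using sub by auto
    then show "y \<in> {Rhaz F u..Rhaz F v}"
      using Rhaz_less[OF strict uv(1), of x] Rhaz_less[OF strict _ uv(2), of x] x by force
  qed
  show "{Rhaz F u..Rhaz F v} \<subseteq> Rhaz F ` {u..v}"
  proof
    fix y assume "y \<in> {Rhaz F u..Rhaz F v}"
    then obtain x where "u \<le> x" "x \<le> v" "Rhaz F x = y"
      using IVT'[of "Rhaz F" u y v] uv(3) continuous_on_Rhaz[OF sub] by auto
    then show "y \<in> Rhaz F ` {u..v}" by auto
  qed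
qed

text \<open>A continuous injection on a compact interval is a homeomorphism onto its image.\<close>

lemma continuous_on_inv_Rhaz:
  assumes strict: "strict_mono_on supp F" and uv: "u \<in> supp" "v \<in> supp" "u < v"
  shows "continuous_on {Rhaz F u..Rhaz F v} (inv_into supp (Rhaz F))"
proof -
  have sub: "{u..v} \<subseteq> supp" using supp_between[OF uv(1,2)] by auto
  have "continuous_on (Rhaz F ` {u..v}) (inv_into supp (Rhaz F))"
  proof (rule continuous_on_inv[OF continuous_on_Rhaz[OF sub]])
    show "\<forall>x\<in>{u..v}. inv_into supp (Rhaz F) (Rhaz F x) = x"
      using inv_into_f_f[OF inj_on_Rhaz[OF strict]] sub by blast
  qed simp
  then show ?thesis
    unfolding Rhaz_image_Icc[OF assms] .
qed

text \<open>Change of variables \<open>s = Rhaz F t\<close>. The formula is applied on the set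
  \<open>S\<close> where \<open>Rhaz F\<close> is known to be differentiable; what \<open>S\<close>
  omits from the interval is null, and so is what its image omits.\<close>

lemma integral_subst_Rhaz:
  assumes strict: "strict_mono_on supp F"
    and uv: "u \<in> supp" "v \<in> supp" "u < v"
    and h: "continuous_on {Rhaz F u..Rhaz F v} h"
  shows "(\<lambda>t. deriv (Rhaz F) t * h (Rhaz F t)) absolutely_integrable_on {u<..<v}"
    and "integral {u<..<v} (\<lambda>t. deriv (Rhaz F) t * h (Rhaz F t)) = integral {Rhaz F u..Rhaz F v} h"
proof -
  obtain N where N: "negligible N" "\<And>x. x \<notin> N \<Longrightarrow> (F has_real_derivative f x) (at x)"
    using has_real_derivative_AE_if_indefinite_integral[OF integrable_on_density F_diff] by blast
  define S where "S = {u<..<v} - N"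
  have sub: "{u<..<v} \<subseteq> supp" "{u..v} \<subseteq> supp" using supp_between[OF uv(1,2)] by auto
  note mono = Rhaz_less[OF strict]
  have inj: "inj_on (Rhaz F) supp"
    using strict by (rule inj_on_Rhaz)
  have S: "S \<in> sets lebesgue"
    unfolding S_def using N(1) by (simp add: negligible_imp_sets sets.Diff)
  have injS: "inj_on (Rhaz F) S"
    by (rule inj_on_subset[OF inj]) (use sub in \<open>auto simp: S_def\<close>)
  have deriv: "(Rhaz F has_real_derivative deriv (Rhaz F) x) (at x)" "0 \<le> deriv (Rhaz F) x" if "x \<in> S" for x
  proof -
    have x: "x \<notin> N" "x \<in> supp" using that sub by (auto simp: S_def)
    have *: "(Rhaz F has_real_derivative f x / (1 - F x)) (at x)"
      by (rule Rhaz_has_derivative[OF N(2)]) (use x in auto)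
    then show "(Rhaz F has_real_derivative deriv (Rhaz F) x) (at x)" "0 \<le> deriv (Rhaz F) x"
      using x f_nonneg[of x] by (auto simp: DERIV_imp_deriv[OF *] supp_def)
  qed
  have image: "Rhaz F ` {u<..<v} = {Rhaz F u<..<Rhaz F v}"
  proof
    show "Rhaz F ` {u<..<v} \<subseteq> {Rhaz F u<..<Rhaz F v}"
      using mono sub uv by auto
    show "{Rhaz F u<..<Rhaz F v} \<subseteq> Rhaz F ` {u<..<v}"
    proof
      fix y assume y: "y \<in> {Rhaz F u<..<Rhaz F v}"
      then have "y \<in> Rhaz F ` {u..v}"
        using Rhaz_image_Icc[OF strict uv] by auto
      then obtain x where x: "u \<le> x" "x \<le> v" "Rhaz F x = y" by auto
      moreover have "x \<noteq> u" "x \<noteq> v" using x y by auto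
      ultimately show "y \<in> Rhaz F ` {u<..<v}" by force
    qed
  qed
  have neg: "negligible ({Rhaz F u..Rhaz F v} - Rhaz F ` S)"
  proof (rule negligible_subset)
    show "negligible (Rhaz F ` ({u<..<v} \<inter> N) \<union> {Rhaz F u, Rhaz F v})"
      using negligible_Rhaz_image[OF N uv strict] by simp
    show "{Rhaz F u..Rhaz F v} - Rhaz F ` S \<subseteq> Rhaz F ` ({u<..<v} \<inter> N) \<union> {Rhaz F u, Rhaz F v}"
    proof
      fix y assume y: "y \<in> {Rhaz F u..Rhaz F v} - Rhaz F ` S"
      show "y \<in> Rhaz F ` ({u<..<v} \<inter> N) \<union> {Rhaz F u, Rhaz F v}"
      proof (cases "y \<in> Rhaz F ` {u<..<v}")
        case True
        with y show ?thesis by (auto simp: S_def)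
      next
        case False
        with y show ?thesis unfolding image by auto
      qed
    qed
  qed
  have RS: "Rhaz F ` S \<subseteq> {Rhaz F u..Rhaz F v}"
  proof -
    have "Rhaz F ` S \<subseteq> Rhaz F ` {u<..<v}" by (auto simp: S_def)
    then show ?thesis unfolding image by auto
  qed
  have negs: "negligible {y \<in> {Rhaz F u..Rhaz F v} - Rhaz F ` S. h y \<noteq> 0}"
    "negligible {y \<in> Rhaz F ` S - {Rhaz F u..Rhaz F v}. h y \<noteq> 0}"
    by (rule negligible_subset[OF neg], blast) (rule negligible_subset[OF negligible_empty], use RS in blast)
  have "h absolutely_integrable_on Rhaz F ` S \<and> integral (Rhaz F ` S) h = integral {Rhaz F u..Rhaz F v} h"
    using absolutely_integrable_spike_set[OF absolutely_integrable_continuous_real[OF h] negs]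
      integral_spike_set[OF negs] by simp
  then have "(\<lambda>t. \<bar>deriv (Rhaz F) t\<bar> * h (Rhaz F t)) absolutely_integrable_on S \<and>
      integral S (\<lambda>t. \<bar>deriv (Rhaz F) t\<bar> * h (Rhaz F t)) = integral {Rhaz F u..Rhaz F v} h"
    by (subst has_absolute_integral_change_of_variables_1'[OF S has_field_derivative_at_within[OF deriv(1)] injS])
  moreover have "(\<lambda>t. \<bar>deriv (Rhaz F) t\<bar> * h (Rhaz F t)) absolutely_integrable_on S \<longleftrightarrow>
      (\<lambda>t. deriv (Rhaz F) t * h (Rhaz F t)) absolutely_integrable_on S"
    by (rule set_integrable_cong) (use deriv(2) in auto)
  moreover have "integral S (\<lambda>t. \<bar>deriv (Rhaz F) t\<bar> * h (Rhaz F t)) =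
      integral S (\<lambda>t. deriv (Rhaz F) t * h (Rhaz F t))"
    by (rule Henstock_Kurzweil_Integration.integral_cong) (use deriv(2) in auto)
  moreover have negs': "negligible {t \<in> S - {u<..<v}. deriv (Rhaz F) t * h (Rhaz F t) \<noteq> 0}"
    "negligible {t \<in> {u<..<v} - S. deriv (Rhaz F) t * h (Rhaz F t) \<noteq> 0}"
    by (auto intro: negligible_subset[OF N(1)] simp: S_def)
  ultimately show "(\<lambda>t. deriv (Rhaz F) t * h (Rhaz F t)) absolutely_integrable_on {u<..<v}"
    "integral {u<..<v} (\<lambda>t. deriv (Rhaz F) t * h (Rhaz F t)) = integral {Rhaz F u..Rhaz F v} h"
    using absolutely_integrable_spike_set[OF _ negs'] integral_spike_set[OF negs'] by auto
qed

text \<open>Writing \<open>k\<close> and \<open>r\<close> as successors removes truncated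
  subtraction; the \<open>j + n + 1\<close> factors \<open>Rhaz F v - Rhaz F u\<close> in the
  denominators are collected in the constant.\<close>

lemma rec_condexp_eq_set_integral:
  assumes "u \<le> v"
  shows "rec_condexp F (Suc j) (Suc n) u v =
    (LINT t:{u<..<v}|lborel. fact (j + n + 1) / (fact j * fact n * (Rhaz F v - Rhaz F u) ^ (j + n + 1)) *
      (deriv (Rhaz F) t * (t * ((Rhaz F t - Rhaz F u) ^ j * (Rhaz F v - Rhaz F t) ^ n))))"
  using assms unfolding rec_condexp_def rec_cdens_def
  by (simp add: interval_lebesgue_integral_le_eq power_divide power_add mult_ac)

text \<open>
  A non-integrable function has Lebesgue integral 0 by convention, so a nonzero conditional mean
  certifies that its integrand, and with it the derivative of \<open>R\<close>, is measurable.
\<close>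

lemma borel_measurable_deriv_Rhaz:
  assumes strict: "strict_mono_on supp F"
    and uv: "u \<in> supp" "v \<in> supp" "u < v"
    and nz: "rec_condexp F (Suc j) (Suc n) u v \<noteq> 0"
  shows "(\<lambda>t. indicator {u<..<v} t * (t * deriv (Rhaz F) t)) \<in> borel_measurable borel"
proof -
  let ?K = "fact (j + n + 1) / (fact j * fact n * (Rhaz F v - Rhaz F u) ^ (j + n + 1))"
  let ?q = "\<lambda>t. (Rhaz F t - Rhaz F u) ^ j * (Rhaz F v - Rhaz F t) ^ n"
  note mono = Rhaz_less[OF strict]
  have "integrable lborel (\<lambda>t. indicator {u<..<v} t * (?K * (deriv (Rhaz F) t * (t * ?q t))))"
    using nz not_integrable_integral_eq unfolding rec_condexp_eq_set_integral[OF less_imp_le[OF uv(3)]] set_lebesgue_integral_def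
    by fastforce
  then have meas: "(\<lambda>t. indicator {u<..<v} t * (?K * (deriv (Rhaz F) t * (t * ?q t)))) \<in> borel_measurable borel"
    using borel_measurable_integrable by fastforce
  \<comment> \<open>The weight \<open>?K * ?q t\<close> is measurable and nonzero inside the
    interval, so it can be divided out of the integrand.\<close>
  have "indicator {u<..<v} t * (t * deriv (Rhaz F) t) =
      indicator {u<..<v} t * (?K * (deriv (Rhaz F) t * (t * ?q t))) / (?K * ?q t)" for t
  proof (cases "t \<in> {u<..<v}")
    case True
    then have "Rhaz F u < Rhaz F t" "Rhaz F t < Rhaz F v" "Rhaz F u < Rhaz F v"
      using mono supp_between[OF uv(1,2), of t] uv by auto
    then have nz: "?K * ?q t \<noteq> 0" by simp
    have cancel: "1 * (K * (d * (t * q))) / (K * q) = t * d" if "K * q \<noteq> 0" for K q d :: real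
      using that by simp
    from True cancel[OF nz] show ?thesis by (simp only: indicator_simps mult_1)
  qed simp
  moreover have "(\<lambda>t. indicator {u<..<v} t * (?K * (deriv (Rhaz F) t * (t * ?q t))) / (?K * ?q t)) \<in> borel_measurable borel"
    using meas by (rule borel_measurable_divide) measurable
  ultimately show ?thesis
    by simp
qed

lemma rec_condexp_eq_integral:
  assumes strict: "strict_mono_on supp F"
    and uv: "u \<in> supp" "v \<in> supp" "u < v"
    and meas: "(\<lambda>t. indicator {u<..<v} t * (t * deriv (Rhaz F) t)) \<in> borel_measurable borel"
  shows "rec_condexp F (Suc j) (Suc n) u v =
    fact (j + n + 1) / (fact j * fact n * (Rhaz F v - Rhaz F u) ^ (j + n + 1)) *
      integral {Rhaz F u..Rhaz F v}
        (\<lambda>s. inv_into supp (Rhaz F) s * ((s - Rhaz F u) ^ j * (Rhaz F v - s) ^ n))"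
proof -
  let ?K = "fact (j + n + 1) / (fact j * fact n * (Rhaz F v - Rhaz F u) ^ (j + n + 1))"
  let ?q = "\<lambda>t. (Rhaz F t - Rhaz F u) ^ j * (Rhaz F v - Rhaz F t) ^ n"
  define h where "h s = inv_into supp (Rhaz F) s * ((s - Rhaz F u) ^ j * (Rhaz F v - s) ^ n)" for s
  have sub: "{u<..<v} \<subseteq> supp" using supp_between[OF uv(1,2)] by auto
  have h: "h (Rhaz F t) = t * ?q t" if "t \<in> {u<..<v}" for t
  proof -
    have "inv_into supp (Rhaz F) (Rhaz F t) = t"
      by (rule inv_into_f_f[OF inj_on_Rhaz[OF strict]]) (use sub that in blast)
    then show ?thesis by (simp add: h_def)
  qed
  have "continuous_on {Rhaz F u..Rhaz F v} h"
    unfolding h_def by (intro continuous_intros continuous_on_inv_Rhaz strict uv)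
  note substitution = integral_subst_Rhaz[OF strict uv this]
  have "(\<lambda>t. indicator {u<..<v} t * (t * deriv (Rhaz F) t) * ?q t) \<in> borel_measurable borel"
    by (rule borel_measurable_times[OF meas]) measurable
  moreover have "indicator {u<..<v} t * (t * deriv (Rhaz F) t) * ?q t
      = indicator {u<..<v} t * (deriv (Rhaz F) t * h (Rhaz F t))" for t
    by (cases "t \<in> {u<..<v}") (simp_all add: h)
  ultimately have "(\<lambda>t. indicator {u<..<v} t * (deriv (Rhaz F) t * h (Rhaz F t))) \<in> borel_measurable lborel"
    by simp
  \<comment> \<open>The substitution yields integrability for the completed measure only; Borel
    measurability brings it down to \<open>lborel\<close>.\<close>
  with substitution(1) have int: "set_integrable lborel {u<..<v} (\<lambda>t. deriv (Rhaz F) t * h (Rhaz F t))"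
    unfolding set_integrable_def real_scaleR_def by (simp only: integrable_completion)
  have "rec_condexp F (Suc j) (Suc n) u v =
      (LINT t:{u<..<v}|lborel. ?K * (deriv (Rhaz F) t * h (Rhaz F t)))"
    unfolding rec_condexp_eq_set_integral[OF less_imp_le[OF uv(3)]]
    by (rule set_lebesgue_integral_cong) (auto simp: h)
  also have "\<dots> = ?K * (LINT t:{u<..<v}|lborel. deriv (Rhaz F) t * h (Rhaz F t))"
    by (rule set_integral_mult_right)
  also have "(LINT t:{u<..<v}|lborel. deriv (Rhaz F) t * h (Rhaz F t)) = integral {Rhaz F u..Rhaz F v} h"
    unfolding set_borel_integral_eq_integral(2)[OF int] by (rule substitution(2))
  finally show ?thesis
    unfolding h_def .
qed

section \<open>Characterisation of the exponential law\<close>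

lemma rec_condexp_eq_0: \<comment> \<open>junk value of the division by 0 in the density\<close>
  assumes "Rhaz F u = Rhaz F v"
  shows "rec_condexp F k r u v = 0"
  unfolding rec_condexp_def rec_cdens_def using assms by simp

text \<open>If \<open>F x = F y\<close>, then the density divides by 0 for the pair
  \<open>x, y\<close> and also for \<open>x\<close> and the midpoint \<open>w\<close>. Both
  conditional means are then 0, whereas the prescribed values differ because
  \<open>B \<noteq> 0\<close>.\<close>

lemma strict_mono_if_rec_condexp:
  assumes mean: "\<And>u v. \<lbrakk>u \<in> supp; v \<in> supp; u < v\<rbrakk> \<Longrightarrow>
      rec_condexp F k r u v = (A * u + B * v) / C" and "B \<noteq> 0" "C \<noteq> 0"
  shows "strict_mono_on supp F"
proof (rule strict_mono_onI)
  fix x y assume xy: "x \<in> supp" "y \<in> supp" "x < y"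
  define w where "w = (x + y) / 2"
  have w: "x < w" "w < y" using xy by (auto simp: w_def)
  have w_supp: "w \<in> supp" using supp_between[OF xy(1,2)] w by simp
  have "F x \<noteq> F y"
  proof
    assume "F x = F y"
    moreover have "F x \<le> F w" "F w \<le> F y" using w by (auto intro: F_mono)
    ultimately have "Rhaz F x = Rhaz F w" "Rhaz F x = Rhaz F y" by (auto simp: Rhaz_def)
    then have "(A * x + B * w) / C = 0" "(A * x + B * y) / C = 0"
      using mean[OF xy(1) w_supp w(1)] mean[OF xy] by (simp_all add: rec_condexp_eq_0)
    then have "A * x + B * w = 0" "A * x + B * y = 0"
      using \<open>C \<noteq> 0\<close> by simp_all
    then have "B * w = B * y" by linarith
    with w \<open>B \<noteq> 0\<close> show False by simp
  qed
  with F_mono[of x y] xy(3) show "F x < F y" by simp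
qed

text \<open>Substitution and removal of the normalising constant bring the regression identity into
  the form that \<open>has_real_derivative_if_beta_means\<close> expects.\<close>

lemma integral_inv_Rhaz_if_rec_condexp:
  assumes mean: "\<And>u v. \<lbrakk>u \<in> supp; v \<in> supp; u < v\<rbrakk> \<Longrightarrow> rec_condexp F (Suc j) (Suc n) u v =
      (real (n + 1) * u + real (j + 1) * v) / real (j + n + 2)"
    and uv: "u \<in> supp" "v \<in> supp" "u < v"
  shows "integral {Rhaz F u..Rhaz F v} (\<lambda>s. inv_into supp (Rhaz F) s * ((s - Rhaz F u) ^ j * (Rhaz F v - s) ^ n)) =
    fact j * fact n / fact (j + n + 2) * (Rhaz F v - Rhaz F u) ^ (j + n + 1) *
      (real (n + 1) * u + real (j + 1) * v)"
    (is "?I = _")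
proof -
  have strict: "strict_mono_on supp F"
    by (rule strict_mono_if_rec_condexp[OF mean]) auto
  \<comment> \<open>The prescribed mean may vanish at \<open>(u, v)\<close>; measurability is then inherited from a longer interval.\<close>
  obtain v' where v': "v' \<in> supp" "v \<le> v'" "real (n + 1) * u + real (j + 1) * v' \<noteq> 0"
  proof (cases "real (n + 1) * u + real (j + 1) * v = 0")
    case True
    obtain w where w: "w \<in> supp" "v < w" using supp_no_max[OF uv(2)] .
    then have "real (j + 1) * v < real (j + 1) * w" by simp
    with True have "real (n + 1) * u + real (j + 1) * w \<noteq> 0" by linarith
    with w show ?thesis by (intro that[of w]) auto
  next
    case False
    with uv show ?thesis by (intro that[of v]) auto
  qed
  have "u < v'" using uv v' by simp
  have meas': "(\<lambda>t. indicator {u<..<v'} t * (t * deriv (Rhaz F) t)) \<in> borel_measurable borel"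
    by (rule borel_measurable_deriv_Rhaz[OF strict uv(1) v'(1) \<open>u < v'\<close>, of j n])
       (use mean[OF uv(1) v'(1) \<open>u < v'\<close>] v'(3) in \<open>simp del: of_nat_Suc of_nat_add\<close>)
  have "(\<lambda>t. indicator {u<..<v} t * (indicator {u<..<v'} t * (t * deriv (Rhaz F) t))) \<in> borel_measurable borel"
    by (rule borel_measurable_times[OF _ meas']) simp
  moreover have "indicator {u<..<v} t * (indicator {u<..<v'} t * (t * deriv (Rhaz F) t))
      = indicator {u<..<v} t * (t * deriv (Rhaz F) t)" for t
    using v'(2) by (simp add: indicator_def)
  ultimately have meas: "(\<lambda>t. indicator {u<..<v} t * (t * deriv (Rhaz F) t)) \<in> borel_measurable borel"
    by simp
  define d where "d = Rhaz F v - Rhaz F u"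
  have d: "d \<noteq> 0" using Rhaz_less[OF strict uv] by (simp add: d_def)
  have "fact (j + n + 1) / (fact j * fact n * d ^ (j + n + 1)) * ?I
      = (real (n + 1) * u + real (j + 1) * v) / real (j + n + 2)"
    using rec_condexp_eq_integral[OF strict uv meas, of j n] mean[OF uv] by (simp only: d_def)
  then have "?I = (real (n + 1) * u + real (j + 1) * v) / real (j + n + 2)
      * (fact j * fact n * d ^ (j + n + 1)) / fact (j + n + 1)"
    using d by (simp add: field_simps del: fact_Suc power_Suc of_nat_Suc of_nat_add)
  \<comment> \<open>The divisor \<open>j + n + 2\<close> is absorbed into the factorial.\<close>
  also have "\<dots> = fact j * fact n / fact (j + n + 2) * d ^ (j + n + 1) * (real (n + 1) * u + real (j + 1) * v)"
    by (simp add: fact_Suc[of "j + n + 1", simplified] del: power_Suc)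
  finally show ?thesis unfolding d_def .
qed

text \<open>The derivative of the inverse hazard at \<open>Rhaz F u\<close> equals the slope of the
  chord to every later point \<open>v\<close>. The slope is therefore independent of
  \<open>v\<close>, and comparing three points shows that it is independent of \<open>u\<close> as
  well.\<close>

lemma affine_if_rec_condexp:
  assumes mean: "\<And>u v j. \<lbrakk>u \<in> supp; v \<in> supp; u < v; j \<in> {m, Suc m}\<rbrakk> \<Longrightarrow> rec_condexp F (Suc j) (Suc n) u v =
      (real (n + 1) * u + real (j + 1) * v) / real (j + n + 2)"
  obtains \<alpha> M where "M > 0" "\<And>x. x \<in> supp \<Longrightarrow> x = \<alpha> + M * Rhaz F x"
proof -
  let ?\<phi> = "inv_into supp (Rhaz F)"
  have strict: "strict_mono_on supp F"
    by (rule strict_mono_if_rec_condexp[OF mean[where j = m]]) auto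
  have inv: "?\<phi> (Rhaz F x) = x" if "x \<in> supp" for x
    using inv_into_f_f[OF inj_on_Rhaz[OF strict] that] .
  have deriv: "(?\<phi> has_real_derivative (v - u) / (Rhaz F v - Rhaz F u)) (at (Rhaz F u))"
    if uv: "u \<in> supp" "v \<in> supp" "u < v" for u v
  proof -
    \<comment> \<open>A point left of \<open>u\<close> makes \<open>Rhaz F u\<close> an interior
      point, as a two-sided derivative requires.\<close>
    obtain w where w: "w \<in> supp" "w < u" using supp_no_min[OF uv(1)] .
    have wv: "w < v" using w uv by simp
    have "(?\<phi> has_real_derivative (?\<phi> (Rhaz F v) - ?\<phi> (Rhaz F u)) / (Rhaz F v - Rhaz F u)) (at (Rhaz F u))"
    proof (rule has_real_derivative_if_beta_means)
      show "continuous_on {Rhaz F w..Rhaz F v} ?\<phi>"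
        by (rule continuous_on_inv_Rhaz[OF strict w(1) uv(2) wv])
      show "Rhaz F w < Rhaz F u" "Rhaz F u < Rhaz F v"
        using Rhaz_less[OF strict] w uv by auto
      fix s j assume s: "Rhaz F w < s" "s < Rhaz F v" and j: "j \<in> {m, Suc m}"
      then have "s \<in> Rhaz F ` {w..v}"
        using Rhaz_image_Icc[OF strict w(1) uv(2) wv] by auto
      then obtain x where x: "w \<le> x" "x \<le> v" "s = Rhaz F x" by auto
      have "x \<in> supp" by (rule supp_between[OF w(1) uv(2) x(1,2)])
      moreover have "x < v" using x s by (cases "x = v") auto
      ultimately show "integral {s..Rhaz F v} (\<lambda>t. ?\<phi> t * ((t - s) ^ j * (Rhaz F v - t) ^ n)) =
          fact j * fact n / fact (j + n + 2) * (Rhaz F v - s) ^ (j + n + 1) *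
          (real (n + 1) * ?\<phi> s + real (j + 1) * ?\<phi> (Rhaz F v))"
        using integral_inv_Rhaz_if_rec_condexp[OF mean[OF _ _ _ j], of x v] uv(2) j
        unfolding x(3) by (simp only: inv)
    qed
    then show ?thesis using inv uv by simp
  qed
  define D where "D x = deriv ?\<phi> (Rhaz F x)" for x
  have D: "y - x = D x * (Rhaz F y - Rhaz F x)" if "x \<in> supp" "y \<in> supp" "x < y" for x y
    using DERIV_imp_deriv[OF deriv[OF that]] Rhaz_less[OF strict that] by (simp add: D_def)
  have D_eq: "D x = D y" if xy: "x \<in> supp" "y \<in> supp" "x < y" for x y
  proof -
    \<comment> \<open>Subtracting the chord from \<open>x\<close> to \<open>y\<close> from the chord
      from \<open>x\<close> to \<open>z\<close> gives slope \<open>D x\<close> between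
      \<open>y\<close> and \<open>z\<close>, where the slope is also \<open>D y\<close>.\<close>
    obtain z where z: "z \<in> supp" "y < z" using supp_no_max[OF xy(2)] .
    have "D y * (Rhaz F z - Rhaz F y) = D x * (Rhaz F z - Rhaz F y)"
      using D[OF xy] D[OF xy(2) z] D[OF xy(1) z(1)] z xy by (simp add: algebra_simps)
    then show ?thesis
      using Rhaz_less[OF strict xy(2) z] by simp
  qed
  obtain x0 where x0: "x0 \<in> supp" using supp_nonempty .
  obtain x1 where x1: "x1 \<in> supp" "x0 < x1" using supp_no_max[OF x0] .
  have "0 < D x0 * (Rhaz F x1 - Rhaz F x0)"
    using D[OF x0 x1] x1 by simp
  then have "D x0 > 0"
    using Rhaz_less[OF strict x0 x1] by (simp add: zero_less_mult_iff)
  moreover have "x = (x0 - D x0 * Rhaz F x0) + D x0 * Rhaz F x" if "x \<in> supp" for x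
  proof (cases x x0 rule: linorder_cases)
    case less
    then show ?thesis using D[OF that x0] D_eq[OF that x0] by (simp add: algebra_simps)
  next
    case greater
    then show ?thesis using D[OF x0 that] by (simp add: algebra_simps)
  qed simp
  ultimately show ?thesis by (rule that)
qed

text \<open>Affinity gives the exponential formula \<open>E\<close> on \<open>supp\<close> only. It
  remains to see that \<open>supp\<close> is the whole half-line beyond \<open>\<alpha>\<close>:
  otherwise \<open>F\<close> would be 0 or 1 at some such point, and a point where \<open>F\<close>
  takes a suitable intermediate level contradicts monotonicity.\<close>

lemma exponential_if_affine:
  assumes "M > 0" and affine: "\<And>x. x \<in> supp \<Longrightarrow> x = \<alpha> + M * Rhaz F x"
  shows "lF F = ereal \<alpha>" "rF F = \<infinity>" "\<And>x. x \<ge> \<alpha> \<Longrightarrow> F x = 1 - exp (- (1 / M) * (x - \<alpha>))"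
proof -
  define E where "E x = 1 - exp (- (1 / M) * (x - \<alpha>))" for x
  have E_mono: "E x \<le> E y" if "x \<le> y" for x y
    using that \<open>M > 0\<close> by (simp add: E_def divide_right_mono)
  have E_less: "E x < 1" for x by (simp add: E_def)
  have E_pos: "0 < E x" if "\<alpha> < x" for x using that \<open>M > 0\<close> by (simp add: E_def)
  have F_E: "F x = E x" if "x \<in> supp" for x
  proof -
    have "(1 / M) * (x - \<alpha>) = Rhaz F x"
      using affine[OF that] \<open>M > 0\<close> by (simp add: field_simps)
    then show ?thesis using exp_Rhaz[OF that] by (simp add: E_def)
  qed
  have supp_gt: "\<alpha> < x" if "x \<in> supp" for x
  proof -
    have "0 < Rhaz F x" using that by (simp add: supp_def Rhaz_def)
    then have "0 < M * Rhaz F x" using \<open>M > 0\<close> by simp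
    with affine[OF that] show ?thesis by linarith
  qed
  have supp_if_gt: "x \<in> supp" if gt: "\<alpha> < x" for x
  proof (rule ccontr)
    assume "x \<notin> supp"
    then consider "F x = 0" | "F x = 1"
      using F_nonneg[of x] F_le_1[of x] by (fastforce simp: supp_def)
    then show False
    proof cases
      case 1
      \<comment> \<open>Since \<open>F w > F x\<close>, the point \<open>w\<close> lies to the right
        of \<open>x\<close>, yet \<open>F w = E w\<close> would be below \<open>E x\<close>.\<close>
      obtain w where w: "F w = E x / 2"
        by (rule F_attains[of "E x / 2"]) (use E_pos[OF gt] E_less[of x] in auto)
      then have "w \<in> supp" using E_pos[OF gt] E_less[of x] by (simp add: supp_def)
      moreover have "x \<le> w"
      proof (rule ccontr)
        assume "\<not> x \<le> w"
        then have "F w \<le> F x" by (intro F_mono) simp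
        with w 1 E_pos[OF gt] show False by simp
      qed
      ultimately have "E x \<le> F w" using F_E E_mono by simp
      with w E_pos[OF gt] show False by simp
    next
      case 2
      \<comment> \<open>The mirror image: now \<open>w\<close> lies to the left of \<open>x\<close>,
        but \<open>F w = E w\<close> would exceed \<open>E x\<close>.\<close>
      obtain w where w: "F w = (E x + 1) / 2"
        by (rule F_attains[of "(E x + 1) / 2"]) (use E_pos[OF gt] E_less[of x] in auto)
      then have "w \<in> supp" using E_pos[OF gt] E_less[of x] by (simp add: supp_def)
      moreover have "w \<le> x"
      proof (rule ccontr)
        assume "\<not> w \<le> x"
        then have "F x \<le> F w" by (intro F_mono) simp
        with w 2 E_less[of x] show False by simp
      qed
      ultimately have "F w \<le> E x" using F_E E_mono by simp
      with w E_less[of x] show False by simp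
    qed
  qed
  have F_0: "F x = 0" if "x \<le> \<alpha>" for x
  proof (rule ccontr)
    assume "F x \<noteq> 0"
    moreover have "F x < 1"
      using F_mono[of x "\<alpha> + 1"] supp_if_gt[of "\<alpha> + 1"] that by (simp add: supp_def)
    ultimately have "x \<in> supp" using F_nonneg[of x] by (simp add: supp_def)
    with supp_gt that show False by force
  qed
  show "F x = 1 - exp (- (1 / M) * (x - \<alpha>))" if "x \<ge> \<alpha>" for x
    using that F_0[of \<alpha>] F_E[OF supp_if_gt, of x] by (cases "x = \<alpha>") (auto simp: E_def)
  have less: "lF F < ereal x \<longleftrightarrow> \<alpha> < x" for x
    by (cases "\<alpha> < x") (use supp_if_gt[of x] F_0[of x] in \<open>auto simp: lF_less_iff supp_def\<close>)
  show "lF F = ereal \<alpha>"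
  proof (rule antisym)
    show "lF F \<le> ereal \<alpha>"
    proof (rule ccontr)
      assume "\<not> lF F \<le> ereal \<alpha>"
      then obtain z where "\<alpha> < z" "ereal z < lF F"
        using ereal_dense2[of "ereal \<alpha>" "lF F"] by (auto simp: not_le)
      with less[of z] show False by simp
    qed
    show "ereal \<alpha> \<le> lF F"
      using less[of \<alpha>] by (simp add: not_less[symmetric])
  qed
  have "ereal x < rF F" for x
  proof -
    have "max x (\<alpha> + 1) \<in> supp" by (rule supp_if_gt) simp
    then show ?thesis
      using F_mono[of x "max x (\<alpha> + 1)"] by (simp add: less_rF_iff supp_def)
  qed
  then show "rF F = \<infinity>"
    by (intro ereal_top less_imp_le)
qed

end

text \<open>The hazard is affine beyond \<open>a\<close>, so its slope \<open>c\<close> cancels and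
  the conditional density is a beta density rescaled to the interval from \<open>u\<close> to
  \<open>v\<close>.\<close>

lemma rec_condexp_exponential:
  assumes "c > 0" and F: "\<And>x. x \<ge> a \<Longrightarrow> F x = 1 - exp (- c * (x - a))" and uv: "a < u" "u < v"
  shows "rec_condexp F (Suc j) (Suc n) u v = (real (n + 1) * u + real (j + 1) * v) / real (j + n + 2)"
proof -
  have R: "Rhaz F x = c * (x - a)" if "x \<ge> a" for x
    using F[OF that] by (simp add: Rhaz_def)
  have deriv_R: "deriv (Rhaz F) t = c" if "t > a" for t
  proof (rule DERIV_imp_deriv)
    have "((\<lambda>x. c * (x - a)) has_real_derivative c) (at t)"
      by (auto intro!: derivative_eq_intros)
    then show "(Rhaz F has_real_derivative c) (at t)"
      by (rule has_field_derivative_transform_within_open[where S = "{a<..}"]) (use that R in auto)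
  qed
  define d where "d = v - u"
  have d: "d > 0" using uv by (simp add: d_def)
  define K where "K = fact (j + n + 1) / (fact j * fact n * d ^ (j + n + 1))"
  let ?g = "\<lambda>i t. (t - u) ^ i * (v - t) ^ n"
  \<comment> \<open>Writing \<open>t = (t - u) + u\<close> splits the mean into two beta integrals,
    with exponents \<open>Suc j\<close> and \<open>j\<close>.\<close>
  have dens: "t * rec_cdens F (Suc j) (Suc n) u v t = K * (?g (Suc j) t + u * ?g j t)" if "t \<in> {u<..<v}" for t
  proof -
    have "Rhaz F t - Rhaz F u = c * (t - u)" "Rhaz F v - Rhaz F t = c * (v - t)" "Rhaz F v - Rhaz F u = c * d"
      using uv that by (simp_all add: R d_def algebra_simps)
    then have "rec_cdens F (Suc j) (Suc n) u v t = K * ?g j t"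
      using \<open>c > 0\<close> uv that unfolding rec_cdens_def K_def
      by (simp add: deriv_R power_divide power_add mult_ac del: fact_Suc)
    then show ?thesis by (simp add: algebra_simps)
  qed
  have cont: "continuous_on {u..v} (\<lambda>t. K * (?g (Suc j) t + u * ?g j t))"
    by (intro continuous_intros)
  have int: "?g i integrable_on {u..v}" for i
    by (intro integrable_continuous_real continuous_intros)
  have "rec_condexp F (Suc j) (Suc n) u v = (LBINT t=u..v. K * (?g (Suc j) t + u * ?g j t))"
    unfolding rec_condexp_def by (rule interval_integral_cong) (use dens uv in \<open>simp add: min_def max_def\<close>)
  also have "\<dots> = integral {u..v} (\<lambda>t. K * (?g (Suc j) t + u * ?g j t))"
    using uv borel_integrable_atLeastAtMost'[OF cont] by (intro interval_integral_eq_integral) auto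
  also have "\<dots> = K * (integral {u..v} (?g (Suc j)) + u * integral {u..v} (?g j))"
    using int[of j] int[of "Suc j"] by (simp add: integral_add integrable_on_mult_right del: power_Suc)
  also have "\<dots> = K * (fact (Suc j) * fact n / fact (j + n + 2) * d ^ (j + n + 2)
      + u * (fact j * fact n / fact (j + n + 1) * d ^ (j + n + 1)))"
    using uv by (simp add: integral_power_mult_power d_def del: power_Suc fact_Suc)
  also have "\<dots> = (real (j + 1) * d) / real (j + n + 2) + u"
  proof -
    have "K * (u * (fact j * fact n / fact (j + n + 1) * d ^ (j + n + 1))) = u"
      using d by (simp add: K_def del: power_Suc fact_Suc)
    moreover have "fact (j + n + 2) = real (j + n + 2) * fact (j + n + 1)" by simp
    then have "K * (fact (Suc j) * fact n / fact (j + n + 2) * d ^ (j + n + 2)) = (real (j + 1) * d) / real (j + n + 2)"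
      using d by (simp add: K_def fact_Suc[of j])
    ultimately show ?thesis by (simp only: distrib_left)
  qed
  also have "\<dots> = (real (n + 1) * u + real (j + 1) * v) / real (j + n + 2)"
    by (simp add: d_def field_simps)
  finally show ?thesis .
qed

theorem mainTheorem4:
  fixes F f :: "real \<Rightarrow> real" and n k r :: nat
  assumes "n \<ge> 3" and "r \<ge> 2" and "2 \<le> k" and "k \<le> n - 1"
    and f_meas: "f \<in> borel_measurable lborel"
    and f_nonneg: "\<And>x. f x \<ge> 0"
    and f_int: "integrable lborel f"
    and f_total: "(LINT t|lborel. f t) = 1"
    and F_def: "\<And>x. F x = (LINT t:{..x}|lborel. f t)"
  shows "((\<forall>u v :: real. lF F < ereal u \<and> u < v \<and> ereal v < rF F \<longrightarrow>
              rec_condexp F k r u v = (real r * u + real k * v) / (real k + real r)) \<and>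
          (\<forall>u u2 v :: real. lF F < ereal u \<and> u < u2 \<and> u2 < v \<and> ereal v < rF F \<longrightarrow>
              rec_condexp F (k - 1) r u2 v = (real r * u2 + (real k - 1) * v) / (real r + real k - 1)))
    \<longleftrightarrow> (\<exists>a c. lF F = ereal a \<and> rF F = \<infinity> \<and> c > 0 \<and>
              (\<forall>x\<ge>a. F x = 1 - exp (- c * (x - a))))"
    (is "?means \<longleftrightarrow> ?exponential")
proof -
  interpret density_cdf f F
    by (unfold_locales) (fact f_meas f_nonneg f_int f_total F_def)+
  \<comment> \<open>The exponents of the left factor in the two regressions, \<open>k - 1\<close>
    and \<open>k - 2\<close>, become \<open>Suc m\<close> and \<open>m\<close>.\<close>
  obtain m where k: "k = Suc (Suc m)"
    using \<open>2 \<le> k\<close> by (metis Suc_le_D numeral_2_eq_2 Suc_le_mono)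
  obtain i where r: "r = Suc i"
    using \<open>r \<ge> 2\<close> by (cases r) auto
  show ?thesis
  proof
    assume means: ?means
    have "rec_condexp F (Suc j) (Suc i) u v = (real (i + 1) * u + real (j + 1) * v) / real (j + i + 2)"
      if uv: "u \<in> supp" "v \<in> supp" "u < v" and j: "j \<in> {m, Suc m}" for u v j
    proof (cases "j = m")
      case True
      \<comment> \<open>The second regression asks for a point \<open>u\<close> below the
        conditioning value \<open>u2\<close>; here \<open>w\<close> takes that role and
        \<open>u\<close> that of \<open>u2\<close>.\<close>
      obtain w where w: "w \<in> supp" "w < u" using supp_no_min[OF uv(1)] .
      have "rec_condexp F (k - 1) r u v = (real r * u + (real k - 1) * v) / (real r + real k - 1)"
        using means w uv unfolding lF_less_iff less_rF_iff supp_def by blast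
      then show ?thesis
        using True by (simp add: k r algebra_simps)
    next
      case False
      have "rec_condexp F k r u v = (real r * u + real k * v) / (real k + real r)"
        using means uv unfolding lF_less_iff less_rF_iff supp_def by blast
      then show ?thesis
        using False j by (simp add: k r algebra_simps)
    qed
    then obtain \<alpha> M where "M > 0" "\<And>x. x \<in> supp \<Longrightarrow> x = \<alpha> + M * Rhaz F x"
      using affine_if_rec_condexp by blast
    \<comment> \<open>The rate \<open>c\<close> is the reciprocal of the slope \<open>M\<close> of
      the inverse hazard.\<close>
    from this(1) exponential_if_affine[OF this] show ?exponential
      by (intro exI[of _ \<alpha>] exI[of _ "1 / M"]) simp
  next
    assume ?exponential
    then obtain a c where a: "lF F = ereal a" and c: "c > 0"
      and F: "\<And>x. x \<ge> a \<Longrightarrow> F x = 1 - exp (- c * (x - a))" by blast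
    note mean = rec_condexp_exponential[where F = F, OF c F]
    show ?means
    proof (intro conjI allI impI)
      fix u v assume "lF F < ereal u \<and> u < v \<and> ereal v < rF F"
      then show "rec_condexp F k r u v = (real r * u + real k * v) / (real k + real r)"
        using mean[of u v "Suc m" i] by (simp add: a k r algebra_simps)
    next
      fix u u2 v assume "lF F < ereal u \<and> u < u2 \<and> u2 < v \<and> ereal v < rF F"
      then show "rec_condexp F (k - 1) r u2 v = (real r * u2 + (real k - 1) * v) / (real r + real k - 1)"
        using mean[of u2 v m i] by (simp add: a k r algebra_simps)
    qed
  qed
qed

end
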